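(* Let $r$ be an integer with $|r|\ge 5$, let $\varepsilon=\operatorname{sgn}(r)\in\{1,-1\}$, and let $u\in\mathbb{Z}[x]$ be nilpotent at $r$ of nilpotency index $|r|$. Then there is a polynomial $p(x)\in\mathbb{Z}[x]$ such that $$u(x)=(x-\varepsilon)+p(x)\prod_{j=1}^{|r|}(x-\varepsilon j).$$
   Context: $\mathbb{N}$ is the set of positive integers. For $u\in\mathbb{Z}[x]$ and $n\in\mathbb{N}$, $u^{(n)}$ denotes the $n$-fold composition $u\circ\cdots\circ u$. For $r\in\mathbb{Z}$, $u$ is called nilpotent at $r$ if there is $n\in\mathbb{N}$ with $u^{(n)}(r)=0$; the smallest such $n$ is called the (nilpotency) index of $u$ at $r$. *)

theory Defs
  imports "HOL-Computational_Algebra.Polynomial"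
begin

definition pcompose_iter :: "int poly \<Rightarrow> nat \<Rightarrow> int poly" where
  "pcompose_iter u n = (pcompose u ^^ n) [:0, 1:]"

text \<open>Here \<open>n\<close> ranges over the positive integers, so \<open>r = 0\<close> is not excused by
  the zeroth iterate: for instance \<open>u = 1\<close> is not nilpotent at \<open>0\<close>.\<close>

definition nilpotent_at :: "int poly \<Rightarrow> int \<Rightarrow> bool" where
  "nilpotent_at u r \<longleftrightarrow> (\<exists>n>0. poly (pcompose_iter u n) r = 0)"

text \<open>Meaningful only when \<open>nilpotent_at u r\<close> holds.\<close>

definition nilpotency_index :: "int poly \<Rightarrow> int \<Rightarrow> nat" where
  "nilpotency_index u r = (LEAST n. n > 0 \<and> poly (pcompose_iter u n) r = 0)"

lemma poly_pcompose_iter: "poly (pcompose_iter u n) r = (poly u ^^ n) r"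
  by (induction n) (simp_all add: pcompose_iter_def poly_pcompose)

end

theory Submission
  imports Defs
begin

text \<open>Write \<open>n = \<bar>r\<bar>\<close>. The orbit \<open>a\<^sub>i = \<epsilon> u\<^sup>(\<^sup>i\<^sup>)(r)\<close> runs from \<open>a\<^sub>0 = n\<close> to \<open>a\<^sub>n = 0\<close> through distinct
  integers, and \<open>a\<^sub>i - a\<^sub>j\<close> divides \<open>a\<^sub>i\<^sub>+\<^sub>1 - a\<^sub>j\<^sub>+\<^sub>1\<close>. So the steps \<open>d\<^sub>i = a\<^sub>i - a\<^sub>i\<^sub>+\<^sub>1\<close> have integral
  ratios \<open>k\<^sub>i = d\<^sub>i\<^sub>+\<^sub>1 / d\<^sub>i\<close>. With \<open>n = R d\<^sub>0\<close> and \<open>d\<^sub>n\<^sub>-\<^sub>1 = K d\<^sub>0\<close>, the divisibility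
  \<open>a\<^sub>0 - a\<^sub>n\<^sub>-\<^sub>1 | a\<^sub>1 - a\<^sub>n\<close> reads \<open>R - K | R - 1\<close>, hence \<open>\<bar>K\<bar> \<le> 2n + 1\<close>.
  On the other hand the ratios \<open>1\<close> are rare unless the orbit starts with a run of them, and a first
  ratio \<open>k\<^sub>q \<noteq> 1\<close> after such a run satisfies \<open>q (q + 1) | k\<^sub>q - 1\<close>; so \<open>K\<close>, the product of the
  \<open>k\<^sub>i\<close>, is too large for \<open>n \<ge> 7\<close> unless every \<open>k\<^sub>i\<close> is \<open>1\<close>. For \<open>n = 5, 6\<close> the few ratio
  sequences with \<open>\<bar>K\<bar> \<le> 13\<close> are enumerated. Thus \<open>a\<^sub>i = n - i\<close>, which prescribes \<open>u\<close> at the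
  \<open>n\<close> points \<open>\<epsilon> j\<close>.\<close>

section \<open>Divisibility facts about polynomials\<close>

lemma diff_dvd_poly_diff:
  fixes p :: "'a::comm_ring_1 poly"
  shows "x - y dvd poly p x - poly p y"
proof (induction p)
  case (pCons c p)
  have "poly (pCons c p) x - poly (pCons c p) y = (x - y) * poly p x + y * (poly p x - poly p y)"
    by (simp add: algebra_simps)
  then show ?case using pCons by simp
qed simp

text \<open>Monic linear factors can be divided out over the ring itself, and without zero divisors
  the quotient keeps the remaining roots. Over the integers this makes the cofactor
  integral.\<close>

lemma prod_linear_dvd_of_roots:
  fixes p :: "'a::idom poly"
  assumes "finite S" "\<And>c. c \<in> S \<Longrightarrow> poly p c = 0"
  shows "(\<Prod>c\<in>S. [:- c, 1:]) dvd p"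
  using assms
proof (induction S arbitrary: p rule: finite_induct)
  case (insert c S)
  then obtain q where q: "p = [:- c, 1:] * q"
    by (metis insertI1 poly_eq_0_iff_dvd dvdE)
  have "poly q b = 0" if "b \<in> S" for b
  proof -
    have "b \<noteq> c" using insert.hyps that by blast
    moreover have "poly p b = 0" using insert.prems that by blast
    ultimately show ?thesis using q by simp
  qed
  then have "(\<Prod>c\<in>S. [:- c, 1:]) dvd q" by (rule insert.IH)
  then show ?case using q insert.hyps by (simp add: mult_dvd_mono del: mult_pCons_left)
qed simp

section \<open>Enumeration of short ratio sequences\<close>

text \<open>Candidates for three consecutive ratios when \<open>n \<le> 6\<close>; the bound is 13 =
  2 * 6 + 1. Pairs are filtered before being extended, which keeps the evaluation small.\<close>

definition small_ratio_triples :: "(int \<times> int \<times> int) list" where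
  "small_ratio_triples =
    (let rs = filter (\<lambda>k. k \<noteq> 0 \<and> k \<noteq> -1) [-13..13];
         ps = filter (\<lambda>(k, l). \<bar>k * l\<bar> \<le> 13 \<and> 1 + k dvd 1 + l) (List.product rs rs)
     in filter (\<lambda>(k, l, m). \<bar>k * l * m\<bar> \<le> 13 \<and> 1 + l dvd 1 + m \<and> 1 + k + k * l dvd 1 + l + l * m)
          (concat (map (\<lambda>(k, l). map (\<lambda>m. (k, l, m)) rs) ps)))"

lemma small_ratio_triples_eq:
  "small_ratio_triples = [(- 3, 1, 3), (- 2, - 3, 1), (- 2, - 2, - 2), (- 2, - 2, 1), (- 2, 1, - 5), (- 2, 1, 1),
     (1, - 3, - 3), (1, - 3, 1), (1, - 3, 3), (1, 1, - 11), (1, 1, - 5), (1, 1, 1), (1, 1, 7),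
     (1, 1, 13), (2, 2, 2)]"
  by code_simp

text \<open>Nonzero integer factors cannot exceed their product in absolute value, so the search
  range -13..13 and the early test on \<open>k * l\<close> lose nothing.\<close>

lemma small_ratio_tripleD:
  fixes k l m :: int
  assumes "k \<noteq> 0" "k \<noteq> -1" "l \<noteq> 0" "l \<noteq> -1" "m \<noteq> 0" "m \<noteq> -1"
    and "\<bar>k * l * m\<bar> \<le> 13" "1 + k dvd 1 + l" "1 + l dvd 1 + m"
    and "1 + k + k * l dvd 1 + l + l * m"
  shows "(k, l, m) \<in> set small_ratio_triples"
proof -
  have le: "\<bar>x\<bar> \<le> \<bar>x * y\<bar>" "\<bar>y\<bar> \<le> \<bar>x * y\<bar>" if "x \<noteq> 0" "y \<noteq> 0" for x y :: int
    using that mult_left_mono[of 1 "\<bar>y\<bar>" "\<bar>x\<bar>"] mult_right_mono[of 1 "\<bar>x\<bar>" "\<bar>y\<bar>"]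
    by (simp_all add: abs_mult)
  have kl: "\<bar>k * l\<bar> \<le> 13" and m: "\<bar>m\<bar> \<le> 13"
    using le[of "k * l" m] assms by (simp_all del: abs_mult)
  have "\<bar>k\<bar> \<le> 13" "\<bar>l\<bar> \<le> 13"
    using le[of k l] kl assms by linarith+
  define rs :: "int list" where "rs = filter (\<lambda>k. k \<noteq> 0 \<and> k \<noteq> -1) [-13..13]"
  have rs: "k \<in> set rs" "l \<in> set rs" "m \<in> set rs"
    using assms m \<open>\<bar>k\<bar> \<le> 13\<close> \<open>\<bar>l\<bar> \<le> 13\<close> by (simp_all add: rs_def abs_le_iff del: upto_rec_numeral)
  then have "(k, l) \<in> set (filter (\<lambda>(k, l). \<bar>k * l\<bar> \<le> 13 \<and> 1 + k dvd 1 + l) (List.product rs rs))"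
    using assms kl by simp
  moreover have "(k, l, m) \<in> set (concat (map (\<lambda>(k, l). map (\<lambda>m. (k, l, m)) rs) ps))"
    if "(k, l) \<in> set ps" for ps
    using that rs(3) by force
  ultimately have "(k, l, m) \<in> set (concat (map (\<lambda>(k, l). map (\<lambda>m. (k, l, m)) rs)
      (filter (\<lambda>(k, l). \<bar>k * l\<bar> \<le> 13 \<and> 1 + k dvd 1 + l) (List.product rs rs))))"
    by blast
  then show ?thesis
    using assms unfolding small_ratio_triples_def Let_def rs_def[symmetric]
    by (simp only: set_filter[where xs = "concat _"] mem_Collect_eq case_prod_conv)
qed

text \<open>The case \<open>n = 5\<close>: the last two hypotheses are R | n and R - K | R - 1, and
  overlapping triples leave finitely many candidates to test.\<close>

lemma four_ratios_eq_1:
  fixes k l m p :: int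
  assumes "(k, l, m) \<in> set small_ratio_triples" "(l, m, p) \<in> set small_ratio_triples"
    and "1 + k + k * l + k * l * m + k * l * m * p dvd 5"
    and "1 + k + k * l + k * l * m dvd k + k * l + k * l * m + k * l * m * p"
  shows "k = 1 \<and> l = 1 \<and> m = 1 \<and> p = 1"
  using assms(1) unfolding small_ratio_triples_eq list.set
  by (elim insertE emptyE; insert assms(2); unfold small_ratio_triples_eq; simp; (elim disjE)?;
      insert assms(3-); simp)

lemma five_ratios_eq_1:
  fixes k l m p q :: int
  assumes "(k, l, m) \<in> set small_ratio_triples" "(l, m, p) \<in> set small_ratio_triples"
    and "(m, p, q) \<in> set small_ratio_triples"
    and "1 + k + k * l + k * l * m + k * l * m * p + k * l * m * p * q dvd 6"
    and "1 + k + k * l + k * l * m + k * l * m * p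
      dvd k + k * l + k * l * m + k * l * m * p + k * l * m * p * q"
  shows "k = 1 \<and> l = 1 \<and> m = 1 \<and> p = 1 \<and> q = 1"
  using assms(1) unfolding small_ratio_triples_eq list.set
  by (elim insertE emptyE; insert assms(2); unfold small_ratio_triples_eq; simp; (elim disjE)?;
      insert assms(3); unfold small_ratio_triples_eq; simp; (elim disjE)?;
      insert assms(4-); simp)

section \<open>Orbits with divisible differences and their step ratios\<close>

text \<open>An orbit detached from its polynomial. The indices in the divisibility stay below
  \<open>n\<close>, so that the successors remain among \<open>a 0\<close>, ...,
  \<open>a n\<close>.\<close>

locale integral_orbit =
  fixes a :: "nat \<Rightarrow> int" and n :: nat
  assumes n_ge: "5 \<le> n"
    and start: "a 0 = int n"
    and stop: "a n = 0"
    and inj: "inj_on a {..n}"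
    and diff_dvd: "i < n \<Longrightarrow> j < n \<Longrightarrow> a i - a j dvd a (Suc i) - a (Suc j)"
begin

definition d :: "nat \<Rightarrow> int" where "d i = a i - a (Suc i)"

text \<open>The division is exact for \<open>Suc i < n\<close>, where consecutive differences divide
  each other.\<close>

definition k :: "nat \<Rightarrow> int" where "k i = d (Suc i) div d i"

text \<open>For \<open>j < n\<close> this is |d (n - 1) / d j|; in particular \<open>tail 0\<close>
  is |K|.\<close>

definition tail :: "nat \<Rightarrow> int" where "tail j = (\<Prod>l=j..<n - 1. \<bar>k l\<bar>)"

lemma a_eq_iff: "i \<le> n \<Longrightarrow> j \<le> n \<Longrightarrow> a i = a j \<longleftrightarrow> i = j"
  using inj by (auto simp: inj_on_def)

lemma d_nonzero: "i < n \<Longrightarrow> d i \<noteq> 0"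
  using a_eq_iff[of i "Suc i"] by (simp add: d_def)

lemma d_Suc: "Suc i < n \<Longrightarrow> d (Suc i) = k i * d i"
  using diff_dvd[of i "Suc i"] by (simp add: d_def k_def)

lemma diff_eq_sum: "a i - a (i + m) = (\<Sum>l<m. d (i + l))"
  by (induction m) (simp_all add: d_def algebra_simps)

lemma sum_dvd:
  assumes "i + m < n"
  shows "(\<Sum>l<m. d (i + l)) dvd (\<Sum>l<m. d (Suc i + l))"
  using diff_dvd[of i "i + m"] assms diff_eq_sum[of i m] diff_eq_sum[of "Suc i" m] by simp

lemma k_neq_0: "Suc i < n \<Longrightarrow> k i \<noteq> 0"
  using d_Suc[of i] d_nonzero[of "Suc i"] by auto

lemma k_neq_minus1:
  assumes "Suc i < n"
  shows "k i \<noteq> -1"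
proof
  assume "k i = -1"
  then have "a i = a (Suc (Suc i))"
    using d_Suc[OF assms] by (simp add: d_def)
  then show False using a_eq_iff[of i "Suc (Suc i)"] assms by simp
qed

text \<open>Compare two adjacent blocks of two steps and cancel \<open>d i\<close>; the surviving
  factor \<open>k i\<close> is coprime to \<open>1 + k i\<close>.\<close>

lemma ratio_dvd:
  assumes "i + 2 < n"
  shows "1 + k i dvd 1 + k (Suc i)"
proof -
  have "d i + d (i + 1) dvd d (i + 1) + d (i + 2)"
    using sum_dvd[of i 2] assms by (simp add: numeral_2_eq_2)
  then have "d i * (1 + k i) dvd d i * (k i * (1 + k (Suc i)))"
    using assms by (simp add: d_Suc algebra_simps)
  then have "1 + k i dvd k i * (1 + k (Suc i))"
    using d_nonzero[of i] assms by simp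
  moreover have "coprime (1 + k i) (k i)"
    by (metis add.commute coprime_add_one_left coprime_commute)
  ultimately show ?thesis by (simp add: coprime_dvd_mult_right_iff)
qed

text \<open>The same comparison for blocks of three steps; the left side is 1 modulo
  \<open>k i\<close>, hence coprime to it.\<close>

lemma ratio_dvd3:
  assumes "i + 3 < n"
  shows "1 + k i + k i * k (i + 1) dvd 1 + k (i + 1) + k (i + 1) * k (i + 2)"
proof -
  have "d i + d (i + 1) + d (i + 2) dvd d (i + 1) + d (i + 2) + d (i + 3)"
    using sum_dvd[of i 3] assms by (simp add: eval_nat_numeral)
  moreover have "d (i + 1) = k i * d i" "d (i + 2) = k (i + 1) * (k i * d i)"
     "d (i + 3) = k (i + 2) * (k (i + 1) * (k i * d i))"
    using assms d_Suc[of i] d_Suc[of "i + 1"] d_Suc[of "i + 2"] by (simp_all add: eval_nat_numeral)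
  ultimately have "d i * (1 + k i + k i * k (i + 1))
      dvd d i * (k i * (1 + k (i + 1) + k (i + 1) * k (i + 2)))"
    by (simp add: algebra_simps)
  then have "1 + k i + k i * k (i + 1) dvd k i * (1 + k (i + 1) + k (i + 1) * k (i + 2))"
    using d_nonzero[of i] assms by (subst (asm) dvd_times_left_cancel_iff) auto
  moreover have "coprime (1 + k i + k i * k (i + 1)) (k i)"
  proof (rule coprimeI)
    fix c assume "c dvd 1 + k i + k i * k (i + 1)" "c dvd k i"
    then have "c dvd (1 + k i + k i * k (i + 1)) - k i * (1 + k (i + 1))"
      by (intro dvd_diff) auto
    then show "is_unit c" by (simp add: algebra_simps)
  qed
  ultimately show ?thesis by (simp add: coprime_dvd_mult_right_iff)
qed

lemma d_eq_prod: "m < n \<Longrightarrow> d m = (\<Prod>l<m. k l) * d 0"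
  by (induction m) (simp_all add: d_Suc)

lemma tail_0: "tail 0 = \<bar>\<Prod>l<n - 1. k l\<bar>"
  by (simp add: tail_def abs_prod atLeast0LessThan)

lemma tail_step: "Suc j < n \<Longrightarrow> tail j = \<bar>k j\<bar> * tail (Suc j)"
  by (simp add: tail_def prod.atLeast_Suc_lessThan)

lemma tail_pos: "1 \<le> tail j"
proof -
  have "(0::int) < tail j"
    unfolding tail_def by (rule prod_pos) (use k_neq_0 in auto)
  then show ?thesis by simp
qed

lemma sum_d_eq:
  assumes "m + i \<le> n"
  shows "(\<Sum>l<m. d (i + l)) = (\<Sum>l<m. \<Prod>t<i + l. k t) * d 0"
  unfolding sum_distrib_right
  by (rule sum.cong[OF refl], rule d_eq_prod) (use assms in auto)

lemma n_eq: "int n = (\<Sum>m<n. \<Prod>l<m. k l) * d 0"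
  using diff_eq_sum[of 0 n] sum_d_eq[of n 0] start stop by simp

lemma ratio_sum_dvd: "(\<Sum>m<n - 1. \<Prod>l<m. k l) dvd (\<Sum>m<n - 1. \<Prod>l<Suc m. k l)"
proof -
  have "(\<Sum>l<n - 1. d (0 + l)) dvd (\<Sum>l<n - 1. d (Suc 0 + l))"
    using sum_dvd[of 0 "n - 1"] n_ge by simp
  moreover have "n - 1 + 0 \<le> n" "n - 1 + Suc 0 \<le> n" using n_ge by simp_all
  ultimately have "(\<Sum>m<n - 1. \<Prod>l<0 + m. k l) * d 0 dvd (\<Sum>m<n - 1. \<Prod>l<Suc 0 + m. k l) * d 0"
    using sum_d_eq by metis
  then show ?thesis using d_nonzero[of 0] n_ge by (simp del: prod.lessThan_Suc)
qed

section \<open>Upper and lower bounds for the product of the ratios\<close>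

text \<open>R | n gives |R| \<le> n, and R - K | R - 1 with R \<noteq> 1 gives |R - K| \<le> |R -
  1|; therefore |K| \<le> |R| + |R - 1| \<le> 2n + 1.\<close>

lemma tail_bound: "tail 0 \<le> 2 * int n + 1"
proof -
  define R where "R = (\<Sum>m<n. \<Prod>l<m. k l)"
  define K where "K = (\<Prod>l<n - 1. k l)"
  have n: "int n = R * d 0" using n_eq by (simp add: R_def)
  have split: "R = (\<Sum>m<n - 1. \<Prod>l<m. k l) + K"
    using n_ge unfolding R_def K_def by (cases n) auto
  have split': "R = 1 + (\<Sum>m<n - 1. \<Prod>l<Suc m. k l)"
    using n_ge unfolding R_def
    by (cases n) (simp_all add: sum.lessThan_Suc_shift del: sum.lessThan_Suc prod.lessThan_Suc)
  have dv: "R - K dvd R - 1"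
  proof -
    have "R - K = (\<Sum>m<n - 1. \<Prod>l<m. k l)" "R - 1 = (\<Sum>m<n - 1. \<Prod>l<Suc m. k l)"
      using split split' by linarith+
    then show ?thesis using ratio_sum_dvd by simp
  qed
  \<comment> \<open>R = 1 would mean \<open>d 0 = n\<close>, so the orbit would already reach 0 at
    index 1.\<close>
  have "R \<noteq> 1"
  proof
    assume "R = 1"
    then have "a 1 = a n" using n start stop by (simp add: d_def)
    then show False using a_eq_iff[of 1 n] n_ge by simp
  qed
  then have "\<bar>R - K\<bar> \<le> \<bar>R - 1\<bar>" using dvd_imp_le_int[OF _ dv] by simp
  moreover have "R dvd int n" using n by simp
  then have "\<bar>R\<bar> \<le> int n" using dvd_imp_le_int[of "int n" R] n_ge by simp
  ultimately show ?thesis unfolding tail_0 K_def[symmetric] by linarith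
qed

text \<open>By \<open>ratio_dvd\<close>, |1 + k l| never decreases along the orbit; once it is at
  least 3, every later ratio has absolute value at least 2.\<close>

lemma tail_exponential:
  assumes "3 \<le> \<bar>1 + k j\<bar>" "j < n - 1"
  shows "2 ^ (n - 1 - j) \<le> tail j"
proof -
  have "3 \<le> \<bar>1 + k l\<bar>" if "j \<le> l" "l < n - 1" for l
    using that
  proof (induction l rule: dec_induct)
    case (step l)
    then have dv: "1 + k l dvd 1 + k (Suc l)" and "k (Suc l) \<noteq> -1"
      using ratio_dvd[of l] k_neq_minus1[of "Suc l"] by auto
    then have "1 + k (Suc l) \<noteq> 0" by linarith
    then show ?case using dvd_imp_le_int[OF _ dv] step by simp
  qed (use assms in simp)
  then have "2 \<le> \<bar>k l\<bar>" if "j \<le> l" "l < n - 1" for l using that by fastforce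
  then have "(\<Prod>l=j..<n - 1. (2::int)) \<le> tail j"
    unfolding tail_def by (intro prod_mono) auto
  then show ?thesis by simp
qed

text \<open>The moduli 3 and 2 force \<open>k (i + 2)\<close> to be 1 modulo 6.\<close>

lemma after_11:
  assumes "i + 3 < n" "k i = 1" "k (i + 1) = 1" "k (i + 2) \<noteq> 1"
  shows "3 \<le> \<bar>1 + k (i + 2)\<bar>"
proof -
  have "3 dvd 2 + k (i + 2)" "2 dvd 1 + k (i + 2)" "k (i + 2) \<noteq> -1"
    using ratio_dvd3[of i] ratio_dvd[of "i + 1"] k_neq_minus1[of "i + 2"] assms
    by (simp_all add: add.commute)
  moreover have "3 \<le> \<bar>1 + x\<bar>" if "3 dvd 2 + x" "2 dvd 1 + x" "x \<noteq> -1" "x \<noteq> 1" for x :: int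
    using that by presburger
  ultimately show ?thesis using assms(4) by blast
qed

text \<open>Here the moduli 5 and 2 force \<open>k (i + 2)\<close> to be 3 modulo 10.\<close>

lemma after_3_1:
  assumes "i + 3 < n" "k i = -3" "k (i + 1) = 1"
  shows "3 \<le> \<bar>1 + k (i + 2)\<bar>"
proof -
  have "-5 dvd 2 + k (i + 2)" "2 dvd 1 + k (i + 2)" "k (i + 2) \<noteq> -1"
    using ratio_dvd3[of i] ratio_dvd[of "i + 1"] k_neq_minus1[of "i + 2"] assms
    by (simp_all add: add.commute)
  moreover have "3 \<le> \<bar>1 + x\<bar>" if "-5 dvd 2 + x" "2 dvd 1 + x" "x \<noteq> -1" for x :: int
    using that by (elim dvdE) presburger
  ultimately show ?thesis by blast
qed

text \<open>The moduli 7 and 2 force \<open>k (i + 2)\<close> to be -3 modulo 14.\<close>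

lemma after_3_3:
  assumes "i + 3 < n" "k i = -3" "k (i + 1) = -3" "k (i + 2) \<noteq> -3"
  shows "3 \<le> \<bar>1 + k (i + 2)\<bar>"
proof -
  have "7 dvd -2 + (-3) * k (i + 2)" "-2 dvd 1 + k (i + 2)" "k (i + 2) \<noteq> -1"
    using ratio_dvd3[of i] ratio_dvd[of "i + 1"] k_neq_minus1[of "i + 2"] assms
    by (simp_all add: add.commute)
  moreover have "3 \<le> \<bar>1 + x\<bar>" if "7 dvd -2 + (-3) * x" "-2 dvd 1 + x" "x \<noteq> -1" "x \<noteq> -3" for x :: int
    using that by (elim dvdE) presburger
  ultimately show ?thesis using assms(4) by blast
qed

text \<open>Both 1 and -3 give |1 + k i| = 2, so \<open>1 + k (i + 1)\<close> is even and nonzero;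
  absolute value 2 leads back to 1 or -3.\<close>

lemma after_1_or_3:
  assumes "i + 2 < n" "k i = 1 \<or> k i = -3"
  shows "k (i + 1) = 1 \<or> k (i + 1) = -3 \<or> 3 \<le> \<bar>1 + k (i + 1)\<bar>"
proof -
  have "2 dvd 1 + k (i + 1)" "k (i + 1) \<noteq> -1"
    using ratio_dvd[of "i"] k_neq_minus1[of "i + 1"] assms by auto
  moreover have "x = 1 \<or> x = -3 \<or> 3 \<le> \<bar>1 + x\<bar>" if "2 dvd 1 + x" "x \<noteq> -1" for x :: int
    using that by presburger
  ultimately show ?thesis by blast
qed

text \<open>The bounds after a ratio \<open>-3\<close> serve only to carry the backward induction over \<open>j\<close>.\<close>

lemma tail_lower_bound:
  assumes no111: "\<And>i. i + 3 < n \<Longrightarrow> k i = 1 \<Longrightarrow> k (i + 1) = 1 \<Longrightarrow> k (i + 2) \<noteq> 1"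
  shows "n = Suc (j + m) \<Longrightarrow> 2 ^ m \<le> 4 * tail j \<and> (0 < m \<and> k j = -3 \<longrightarrow> 2 ^ m \<le> 2 * tail j)
    \<and> (1 < m \<and> k j = -3 \<and> k (j + 1) = -3 \<longrightarrow> 2 ^ m \<le> tail j)"
proof (induction m arbitrary: j)
  case 0
  then show ?case using tail_pos[of j] by simp
next
  case (Suc m)
  have j: "Suc j < n" and IH: "2 ^ m \<le> 4 * tail (j + 1)"
    "0 < m \<Longrightarrow> k (j + 1) = -3 \<Longrightarrow> 2 ^ m \<le> 2 * tail (j + 1)"
    "1 < m \<Longrightarrow> k (j + 1) = -3 \<Longrightarrow> k (j + 2) = -3 \<Longrightarrow> 2 ^ m \<le> tail (j + 1)"
    using Suc.IH[of "j + 1"] Suc.prems by auto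
  have st: "tail j = \<bar>k j\<bar> * tail (j + 1)" using tail_step[OF j] by simp
  have big: "2 ^ (m - i) \<le> tail (j + 1 + i)" if "3 \<le> \<bar>1 + k (j + 1 + i)\<bar>" "i < m" for i
    using tail_exponential[of "j + 1 + i"] that Suc.prems by simp
  have step2: "tail (j + 1) = \<bar>k (j + 1)\<bar> * tail (j + 2)" if "0 < m"
    using tail_step[of "j + 1"] that Suc.prems by simp
  have pos: "1 \<le> tail (j + 1)" "1 \<le> tail (j + 2)" by (rule tail_pos)+
  \<comment> \<open>A third -3 is handled by induction. Any other ratio starts exponential growth at
    \<open>j + 2\<close>, and the two factors 3 more than pay for two doublings.\<close>
  have B: "2 ^ Suc m \<le> tail j" if "1 < Suc m" "k j = -3" "k (j + 1) = -3"
  proof (cases "m = 1")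
    case True
    then show ?thesis using that st step2 tail_pos[of "Suc (Suc j)"] by simp
  next
    case False
    then have "2 \<le> m" using that by linarith
    then obtain m' where m': "m = m' + 2" using le_Suc_ex[of 2 m] by auto
    show ?thesis
    proof (cases "k (j + 2) = -3")
      case True
      then show ?thesis using IH(3) that m' st tail_pos[of "Suc j"] by simp
    next
      case False
      then have "3 \<le> \<bar>1 + k (j + 2)\<bar>" using after_3_3[of j] that m' Suc.prems by simp
      then have "2 ^ (m - 1) \<le> tail (j + 2)" using big[of 1] m' by simp
      then show ?thesis using that st step2 m' tail_pos[of "Suc (Suc j)"] by simp
    qed
  qed
  have A: "2 ^ Suc m \<le> 2 * tail j" if k3: "k j = -3"
  proof (cases "m = 0")
    case True
    then show ?thesis using tail_pos[of j] by simp
  next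
    case m: False
    consider "k (j + 1) = -3" | "k (j + 1) = 1" | "3 \<le> \<bar>1 + k (j + 1)\<bar>"
      using after_1_or_3[of j] k3 m Suc.prems by auto
    then show ?thesis
    proof cases
      case 1
      then show ?thesis using B that m tail_pos[of j] by simp
    next
      case 2
      show ?thesis
      proof (cases "m = 1")
        case True
        then show ?thesis using that st pos by simp
      next
        case False
        then have "2 \<le> m" using m by linarith
        then obtain m' where m': "m = m' + 2" using le_Suc_ex[of 2 m] by auto
        have "3 \<le> \<bar>1 + k (j + 2)\<bar>" using after_3_1[of j] that 2 m' Suc.prems by simp
        then have "2 ^ (m - 1) \<le> tail (j + 2)" using big[of 1] m' by simp
        then show ?thesis using that 2 st step2 m' tail_pos[of "Suc (Suc j)"] by simp
      qed
    next
      case 3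
      then show ?thesis using big[of 0] m st that pos by simp
    qed
  qed
  \<comment> \<open>A ratio other than 1 doubles the bound for \<open>j + 1\<close>. After a ratio
    1, at most one more 1 can follow, so at most two doublings are lost; this is the factor
    4.\<close>
  have C: "2 ^ Suc m \<le> 4 * tail j"
  proof (cases "k j = 1")
    case k1: True
    show ?thesis
    proof (cases "m \<le> 1")
      case True
      then have "(2::int) ^ Suc m \<le> 2 ^ 2" by (intro power_increasing) auto
      then show ?thesis using tail_pos[of j] by simp
    next
      case False
      then obtain m' where m': "m = m' + 2" using le_Suc_ex[of 2 m] by auto
      consider "k (j + 1) = -3" | "k (j + 1) = 1" | "3 \<le> \<bar>1 + k (j + 1)\<bar>"
        using after_1_or_3[of j] k1 m' Suc.prems by auto
      then show ?thesis
      proof cases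
        case 1
        then show ?thesis using IH(2) m' st k1 by simp
      next
        case 2
        then have "k (j + 2) \<noteq> 1" using no111[of j] k1 m' Suc.prems by simp
        then have "3 \<le> \<bar>1 + k (j + 2)\<bar>" using after_11[of j] k1 2 m' Suc.prems by simp
        then have "2 ^ (m - 1) \<le> tail (j + 2)" using big[of 1] m' by simp
        then show ?thesis using k1 2 st step2 m' tail_pos[of "Suc (Suc j)"] by simp
      next
        case 3
        then show ?thesis using big[of 0] m' st k1 pos by simp
      qed
    qed
  next
    case False
    then have "2 \<le> \<bar>k j\<bar>" using k_neq_0[OF j] k_neq_minus1[OF j] by linarith
    then have "2 * tail (j + 1) \<le> tail j" using st pos by (simp add: mult_right_mono)
    then show ?thesis using IH(1) by simp
  qed
  show ?case using A B C by simp
qed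

section \<open>Runs of ratios equal to 1\<close>

text \<open>\<open>1 + k i\<close> divides 2, which leaves 1, -2 and -3. Blocks of three steps
  exclude -3, but -2 passes that test and needs blocks of four, where -5 would have to divide
  -8.\<close>

lemma before_111:
  assumes "i + 4 < n" "k (i + 1) = 1" "k (i + 2) = 1" "k (i + 3) = 1"
  shows "k i = 1"
proof -
  have dv: "1 + k i dvd 2" using ratio_dvd[of i] assms by simp
  have "\<bar>1 + k i\<bar> \<le> 2" using dvd_imp_le_int[OF _ dv] by simp
  moreover have "1 + k i + k i dvd 3" using ratio_dvd3[of i] assms by simp
  then have "k i \<noteq> -3" by auto
  moreover have "k i \<noteq> -2"
  proof
    assume k: "k i = -2"
    have "d i + d (i + 1) + d (i + 2) + d (i + 3) dvd d (i + 1) + d (i + 2) + d (i + 3) + d (i + 4)"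
      using sum_dvd[of i 4] assms by (simp add: eval_nat_numeral)
    moreover have "d (i + 1) = -2 * d i" "d (i + 2) = -2 * d i" "d (i + 3) = -2 * d i"
      "d (i + 4) = -2 * d i"
      using assms k d_Suc[of i] d_Suc[of "i + 1"] d_Suc[of "i + 2"] d_Suc[of "i + 3"]
      by (simp_all add: eval_nat_numeral)
    ultimately have "d i * (-5) dvd d i * (-8)" by (simp add: algebra_simps)
    then show False using d_nonzero[of i] assms by (subst (asm) dvd_times_left_cancel_iff) auto
  qed
  ultimately show ?thesis using k_neq_0[of i] k_neq_minus1[of i] assms by linarith
qed

lemma run_at_start:
  assumes "i + 3 < n" "k i = 1" "k (i + 1) = 1" "k (i + 2) = 1"
  shows "k 0 = 1 \<and> k 1 = 1 \<and> k 2 = 1"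
  using assms
proof (induction i)
  case 0
  then show ?case by (simp add: numeral_2_eq_2)
next
  case (Suc i)
  then show ?case using before_111[of i] by (simp add: eval_nat_numeral)
qed

text \<open>A block of m equal steps ending at \<open>d q\<close> divides its shift, in which one
  step is replaced by \<open>k q * d 0\<close>; so m | k q - 1. The coprime lengths q and q + 1 are
  combined.\<close>

lemma run_then_big:
  assumes q: "2 \<le> q" "q < n - 1" and ones: "\<And>i. i < q \<Longrightarrow> k i = 1" and "k q \<noteq> 1"
  shows "int (q * (q + 1)) \<le> \<bar>k q - 1\<bar>"
proof -
  have d: "d i = d 0" if "i \<le> q" for i
    using that
  proof (induction i)
    case (Suc i)
    then show ?case using d_Suc[of i] ones[of i] q by simp
  qed simp
  have dq: "d (Suc q) = k q * d 0" using d_Suc[of q] d[of q] q by simp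
  have d0: "d 0 \<noteq> 0" using d_nonzero n_ge by simp
  have dv: "int m dvd k q - 1" if m: "m = q \<or> m = q + 1" for m
  proof -
    \<comment> \<open>The block of length \<open>m\<close> must end with step \<open>q\<close>, so
      it starts at 0 for \<open>m = q + 1\<close> and at 1 for \<open>m = q\<close>.\<close>
    define i where "i = q + 1 - m"
    have im: "Suc i + m = Suc (Suc q)" using m q by (auto simp: i_def)
    have s1: "(\<Sum>l<m. d (i + l)) = int m * d 0"
    proof -
      have "(\<Sum>l<m. d (i + l)) = (\<Sum>l<m. d 0)"
        by (rule sum.cong[OF refl], rule d) (use im in auto)
      then show ?thesis by simp
    qed
    obtain m' where m': "m = Suc m'" using m q by (cases m) auto
    have s2: "(\<Sum>l<m. d (Suc i + l)) = (int m - 1 + k q) * d 0"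
    proof -
      have "(\<Sum>l<m'. d (Suc i + l)) = (\<Sum>l<m'. d 0)"
        by (rule sum.cong[OF refl], rule d) (use im m' in auto)
      moreover have "Suc i + m' = Suc q" using im m' by simp
      ultimately show ?thesis unfolding m' by (simp add: dq algebra_simps)
    qed
    have "d 0 * int m dvd d 0 * (int m - 1 + k q)"
      using sum_dvd[of i m] s1 s2 im q by (simp add: mult.commute)
    then have "int m dvd int m - 1 + k q"
      using d0 by (subst (asm) dvd_times_left_cancel_iff) auto
    then have "int m dvd (int m - 1 + k q) - int m" by (intro dvd_diff) auto
    then show ?thesis by simp
  qed
  have "coprime (int q) (int (q + 1))"
    by (metis add.commute coprime_add_one_right of_nat_Suc Suc_eq_plus1)
  then have "int q * int (q + 1) dvd k q - 1"
    using dv[of q] dv[of "q + 1"] by (intro divides_mult) blast+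
  then show ?thesis using dvd_imp_le_int[of "k q - 1" "int q * int (q + 1)"] assms
    by (simp add: algebra_simps)
qed

section \<open>All ratios are 1: the cases n = 5, 6 and n \<ge> 7\<close>

text \<open>The omitted ratios have absolute value at least 1, so three consecutive ones have
  product at most \<open>tail 0\<close>, hence at most 13.\<close>

lemma triple:
  assumes "i + 3 < n" "n \<le> 6"
  shows "(k i, k (i + 1), k (i + 2)) \<in> set small_ratio_triples"
proof -
  have "(\<Prod>l\<in>{i, i + 1, i + 2}. \<bar>k l\<bar>) \<le> tail 0"
    unfolding tail_def
  proof (rule prod_mono2)
    show "1 \<le> \<bar>k l\<bar>" if "l \<in> {0..<n - 1} - {i, i + 1, i + 2}" for l
    proof -
      have "k l \<noteq> 0" using that by (intro k_neq_0) auto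
      then show ?thesis by linarith
    qed
  qed (use assms in auto)
  moreover have "tail 0 \<le> 13" using tail_bound assms by linarith
  ultimately have "\<bar>k i * k (i + 1) * k (i + 2)\<bar> \<le> 13"
    by (simp add: abs_mult mult.assoc)
  then show ?thesis
    using assms k_neq_0[of i] k_neq_0[of "i + 1"] k_neq_0[of "i + 2"]
      k_neq_minus1[of i] k_neq_minus1[of "i + 1"] k_neq_minus1[of "i + 2"]
      ratio_dvd[of i] ratio_dvd[of "i + 1"] ratio_dvd3[of i]
    by (intro small_ratio_tripleD) simp_all
qed

lemma ratio_eq_1_small:
  assumes "n \<le> 6" "i < n - 1"
  shows "k i = 1"
proof -
  have R: "(\<Sum>m<n. \<Prod>l<m. k l) dvd int n" using n_eq by (metis dvd_triv_left)
  consider "n = 5" | "n = 6" using assms n_ge by linarith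
  then show ?thesis
  proof cases
    case 1
    have "k 0 = 1 \<and> k 1 = 1 \<and> k 2 = 1 \<and> k 3 = 1"
    proof (rule four_ratios_eq_1)
      show "(k 0, k 1, k 2) \<in> set small_ratio_triples" "(k 1, k 2, k 3) \<in> set small_ratio_triples"
        using triple[of 0] triple[of 1] 1 by (simp_all add: eval_nat_numeral)
    qed (use R ratio_sum_dvd 1 in \<open>simp_all add: eval_nat_numeral lessThan_Suc ac_simps\<close>)
    moreover have "i = 0 \<or> i = 1 \<or> i = 2 \<or> i = 3" using assms 1 by auto
    ultimately show ?thesis by auto
  next
    case 2
    have "k 0 = 1 \<and> k 1 = 1 \<and> k 2 = 1 \<and> k 3 = 1 \<and> k 4 = 1"
    proof (rule five_ratios_eq_1)
      show "(k 0, k 1, k 2) \<in> set small_ratio_triples" "(k 1, k 2, k 3) \<in> set small_ratio_triples"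
        "(k 2, k 3, k 4) \<in> set small_ratio_triples"
        using triple[of 0] triple[of 1] triple[of 2] 2 by (simp_all add: eval_nat_numeral)
    qed (use R ratio_sum_dvd 2 in \<open>simp_all add: eval_nat_numeral lessThan_Suc ac_simps\<close>)
    moreover have "i = 0 \<or> i = 1 \<or> i = 2 \<or> i = 3 \<or> i = 4" using assms 2 by auto
    ultimately show ?thesis by auto
  qed
qed

lemma ratio_eq_1_large:
  assumes n7: "7 \<le> n" and "i < n - 1"
  shows "k i = 1"
proof (rule ccontr)
  assume "k i \<noteq> 1"
  show False
  proof (cases "\<exists>j. j + 3 < n \<and> k j = 1 \<and> k (j + 1) = 1 \<and> k (j + 2) = 1")
    case False
    then have "2 ^ (n - 1) \<le> 4 * tail 0"
      using tail_lower_bound[of 0 "n - 1"] n_ge by auto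
    then have "(2::int) ^ (n - 1) \<le> 8 * int n + 4" using tail_bound by simp
    \<comment> \<open>This is where 7 enters: 60 < 64 at \<open>n = 7\<close>, while at
      \<open>n = 6\<close> the inequality fails.\<close>
    moreover have "8 * int n + 4 < 2 ^ (n - 1)"
      using n7
    proof (induction n rule: dec_induct)
      case (step m)
      then have "(2::int) ^ (Suc m - 1) = 2 * 2 ^ (m - 1)" by (cases m) auto
      then show ?case using step by simp
    qed simp
    ultimately show False by simp
  next
    case True
    then have start111: "k 0 = 1" "k 1 = 1" "k 2 = 1" using run_at_start by auto
    define q where "q = (LEAST q. k q \<noteq> 1)"
    have kq: "k q \<noteq> 1" unfolding q_def by (rule LeastI) fact
    have ones: "k l = 1" if "l < q" for l using not_less_Least that unfolding q_def by blast
    have "q \<le> i" unfolding q_def by (rule Least_le) fact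
    then have qn: "q < n - 1" using assms by simp
    have q3: "3 \<le> q"
    proof (rule ccontr)
      assume "\<not> 3 \<le> q"
      then have "q = 0 \<or> q = 1 \<or> q = 2" by auto
      then show False using kq start111 by auto
    qed
    have "int (q * (q + 1)) \<le> \<bar>k q - 1\<bar>" using run_then_big qn q3 ones kq by simp
    then have kb: "int (q * (q + 1)) - 1 \<le> \<bar>k q\<bar>" by linarith
    have qq: "3 * int (q + 1) \<le> int (q * (q + 1))"
      unfolding of_nat_mult using q3 by (intro mult_right_mono) auto
    have "12 \<le> int (q * (q + 1))" using order_trans[OF _ qq] q3 by simp
    then have k11: "11 \<le> \<bar>k q\<bar>" using kb by linarith
    have "tail l = tail 0" if "l \<le> q" for l
      using that
    proof (induction l)
      case (Suc l)
      then show ?case using tail_step[of l] ones[of l] qn by simp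
    qed simp
    then have "tail q = tail 0" by blast
    then have t0: "tail 0 = \<bar>k q\<bar> * tail (Suc q)" using tail_step[of q] qn by simp
    \<comment> \<open>The large ratio at \<open>q\<close> makes all later ones at least 2 in
      absolute value; if \<open>q\<close> is the last ratio, the product is empty and the exponent
      is 0.\<close>
    have "2 ^ (n - 2 - q) \<le> tail (Suc q)"
    proof (cases "Suc q < n - 1")
      case True
      have dv: "1 + k q dvd 1 + k (Suc q)" using ratio_dvd[of q] True by simp
      have "k (Suc q) \<noteq> -1" using k_neq_minus1[of "Suc q"] True by simp
      then have "1 + k (Suc q) \<noteq> 0" by linarith
      then have "\<bar>1 + k q\<bar> \<le> \<bar>1 + k (Suc q)\<bar>" using dvd_imp_le_int[OF _ dv] by simp
      then have "3 \<le> \<bar>1 + k (Suc q)\<bar>" using k11 by linarith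
      then show ?thesis using tail_exponential[of "Suc q"] True by (simp add: eval_nat_numeral)
    next
      case False
      then show ?thesis using tail_pos[of "Suc q"] by simp
    qed
    moreover have "int m + 1 \<le> 2 ^ m" for m
      by (induction m) auto
    ultimately have "int (n - 2 - q) + 1 \<le> tail (Suc q)" by (meson order_trans)
    then have "int n - 1 - int q \<le> tail (Suc q)" using qn by (simp add: of_nat_diff)
    then have "(int (q * (q + 1)) - 1) * (int n - 1 - int q) \<le> tail 0"
      unfolding t0 using kb qq qn q3 by (intro mult_mono) auto
    then have le: "(int (q * (q + 1)) - 1) * (int n - 1 - int q) \<le> 2 * int n + 1"
      using tail_bound by simp
    show False
    \<comment> \<open>For \<open>q = 3\<close> the inequality reads 11 (n - 4) \<le> 2n + 1, which
      is false for \<open>n \<ge> 7\<close>. For larger \<open>q\<close>, writing n - 1 - q = 1 + (n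
      - 2 - q) bounds its left side below by 4q + 3 + 2 (n - 2 - q) = 2n + 2q - 1.\<close>
    proof (cases "q = 3")
      case True
      then show False using le n7 by simp
    next
      case False
      have "4 * int (q + 1) \<le> int (q * (q + 1))"
        unfolding of_nat_mult using q3 False by (intro mult_right_mono) auto
      moreover have "2 * (int n - 2 - int q) \<le> (int (q * (q + 1)) - 1) * (int n - 2 - int q)"
        using qq q3 qn by (intro mult_right_mono) auto
      ultimately show False using le q3 by (simp add: algebra_simps)
    qed
  qed
qed

text \<open>All \<open>n\<close> steps are equal and add up to \<open>n\<close>, so each is
  1.\<close>

lemma arithmetic:
  assumes "i \<le> n"
  shows "a i = int n - int i"
proof -
  have k: "k l = 1" if "l < n - 1" for l
    using ratio_eq_1_small ratio_eq_1_large that by (cases "n \<le> 6") auto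
  have d: "d l = d 0" if "l < n" for l
    using that d_eq_prod[of l] k by simp
  have sum: "(\<Sum>l<m. d l) = int m * d 0" if "m \<le> n" for m
  proof -
    have "(\<Sum>l<m. d l) = (\<Sum>l<m. d 0)"
      by (rule sum.cong[OF refl], rule d) (use that in auto)
    then show ?thesis by simp
  qed
  have "int n = int n * d 0"
    using diff_eq_sum[of 0 n] sum[of n] start stop by simp
  then have "d 0 = 1" using n_ge by simp
  then have "a 0 - a i = int i"
    using diff_eq_sum[of 0 i] sum[of i] assms by simp
  then show ?thesis using start by simp
qed

end

section \<open>From the nilpotent polynomial to its orbit and back\<close>

lemma integral_orbit_of_nilpotent:
  fixes r \<epsilon> :: int and u :: "int poly"
  assumes r: "\<bar>r\<bar> \<ge> 5" and \<epsilon>: "\<epsilon> = sgn r"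
    and nil: "nilpotent_at u r" and idx: "nilpotency_index u r = nat \<bar>r\<bar>"
  shows "integral_orbit (\<lambda>i. \<epsilon> * (poly u ^^ i) r) (nat \<bar>r\<bar>)"
proof -
  define n where "n = nat \<bar>r\<bar>"
  define f where "f i = (poly u ^^ i) r" for i
  have fS: "f (i + m) = (poly u ^^ m) (f i)" for i m
    by (metis f_def add.commute comp_apply funpow_add)
  have n_least: "n = (LEAST m. 0 < m \<and> f m = 0)"
    using idx by (simp add: n_def f_def nilpotency_index_def poly_pcompose_iter)
  have "\<exists>m. 0 < m \<and> f m = 0"
    using nil by (auto simp: nilpotent_at_def f_def poly_pcompose_iter)
  then have fn: "f n = 0"
    unfolding n_least by (metis (mono_tags, lifting) LeastI_ex)
  \<comment> \<open>Minimality of the index says nothing about \<open>m = 0\<close>; there the value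
    is \<open>r\<close> itself.\<close>
  have nz: "f m \<noteq> 0" if "m < n" for m
  proof (cases m)
    case 0
    then show ?thesis using r by (auto simp: f_def)
  next
    case (Suc m')
    then show ?thesis using not_less_Least[of m "\<lambda>m. 0 < m \<and> f m = 0"] that n_least by auto
  qed
  \<comment> \<open>A repetition, moved forward by \<open>n - j\<close> iterations, would produce a
    zero before index \<open>n\<close>.\<close>
  have ne: "f i \<noteq> f j" if "i < j" "j \<le> n" for i j
  proof
    assume "f i = f j"
    then have "f (i + (n - j)) = f (j + (n - j))" by (simp only: fS)
    moreover have "i + (n - j) < n" "j + (n - j) = n" using that by linarith+
    ultimately show False using nz fn by metis
  qed
  have e: "\<epsilon> * \<epsilon> = 1" "\<epsilon> \<noteq> 0" using r \<epsilon> by (auto simp: sgn_if)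
  show ?thesis
    unfolding n_def[symmetric] f_def[symmetric]
  proof
    show "5 \<le> n" using r by (simp add: n_def)
    show "\<epsilon> * f 0 = int n" using \<epsilon> by (simp add: f_def n_def sgn_if)
    show "\<epsilon> * f n = 0" using fn by simp
    show "inj_on (\<lambda>i. \<epsilon> * f i) {..n}"
    proof (rule inj_onI)
      fix i j assume "i \<in> {..n}" "j \<in> {..n}" "\<epsilon> * f i = \<epsilon> * f j"
      then show "i = j" using ne[of i j] ne[of j i] e by (cases i j rule: linorder_cases) auto
    qed
    fix i j
    have "f i - f j dvd poly u (f i) - poly u (f j)"
      by (rule diff_dvd_poly_diff)
    then show "\<epsilon> * f i - \<epsilon> * f j dvd \<epsilon> * f (Suc i) - \<epsilon> * f (Suc j)"
      by (simp add: f_def mult_dvd_mono flip: right_diff_distrib)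
  qed
qed

theorem theorem1p6:
  fixes r \<epsilon> :: int and u :: "int poly"
  assumes "\<bar>r\<bar> \<ge> 5"
    and "\<epsilon> = sgn r"
    and "nilpotent_at u r"
    and "nilpotency_index u r = nat \<bar>r\<bar>"
  shows "\<exists>p :: int poly.
    u = [:- \<epsilon>, 1:] + p * (\<Prod>j = 1..\<bar>r\<bar>. [:- (\<epsilon> * j), 1:])"
proof -
  have e: "\<epsilon> * \<epsilon> = 1" "\<epsilon> \<noteq> 0" using assms by (auto simp: sgn_if)
  have orbit: "(poly u ^^ i) r = \<epsilon> * (\<bar>r\<bar> - int i)" if "i \<le> nat \<bar>r\<bar>" for i
  proof -
    have "\<epsilon> * (poly u ^^ i) r = \<bar>r\<bar> - int i"
      using integral_orbit.arithmetic[OF integral_orbit_of_nilpotent[OF assms] that] by simp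
    then show ?thesis using e by (metis mult.assoc mult_1)
  qed
  have val: "poly u (\<epsilon> * j) = \<epsilon> * (j - 1)" if "j \<in> {1..\<bar>r\<bar>}" for j
  proof -
    \<comment> \<open>The orbit passes through \<open>\<epsilon> * j\<close> at this index, and its
      next value is \<open>\<epsilon> * (j - 1)\<close>.\<close>
    define i where "i = nat (\<bar>r\<bar> - j)"
    have "Suc i \<le> nat \<bar>r\<bar>" using that assms(1) by (auto simp: i_def Suc_le_eq)
    then have "poly u ((poly u ^^ i) r) = \<epsilon> * (\<bar>r\<bar> - int (Suc i))"
      using orbit[of "Suc i"] by simp
    moreover have "(poly u ^^ i) r = \<epsilon> * j"
      using orbit[of i] \<open>Suc i \<le> nat \<bar>r\<bar>\<close> that by (simp add: i_def)
    ultimately show ?thesis using that by (simp add: i_def)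
  qed
  \<comment> \<open>\<open>u\<close> and x - \<epsilon> agree at every
    \<open>\<epsilon> * j\<close>. Indexing by the set of roots fits the divisibility lemma;
    injectivity of j \<mapsto> \<epsilon> j then restores the index \<open>j\<close>.\<close>
  have "(\<Prod>c\<in>(\<lambda>j. \<epsilon> * j) ` {1..\<bar>r\<bar>}. [:- c, 1:]) dvd u - [:- \<epsilon>, 1:]"
  proof (rule prod_linear_dvd_of_roots)
    fix c assume "c \<in> (\<lambda>j. \<epsilon> * j) ` {1..\<bar>r\<bar>}"
    then obtain j where "j \<in> {1..\<bar>r\<bar>}" "c = \<epsilon> * j" by blast
    then show "poly (u - [:- \<epsilon>, 1:]) c = 0" using val[of j] by (simp add: algebra_simps)
  qed simp
  moreover have "inj_on (\<lambda>j. \<epsilon> * j) {1..\<bar>r\<bar>}" using e by (auto simp: inj_on_def)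
  ultimately have "(\<Prod>j = 1..\<bar>r\<bar>. [:- (\<epsilon> * j), 1:]) dvd u - [:- \<epsilon>, 1:]"
    by (simp add: prod.reindex)
  then obtain p where "u - [:- \<epsilon>, 1:] = (\<Prod>j = 1..\<bar>r\<bar>. [:- (\<epsilon> * j), 1:]) * p" by (rule dvdE)
  then have "u = [:- \<epsilon>, 1:] + p * (\<Prod>j = 1..\<bar>r\<bar>. [:- (\<epsilon> * j), 1:])"
    by (simp add: algebra_simps)
  then show ?thesis ..
qed

end
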